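(* Let $A\subseteq\mathbb{N}$ and $\alpha\ge-1$. For every $x\in[\underline{d}_\alpha(A),\overline{d}_\alpha(A)]$ there is a free ultrafilter $\mathcal{F}$ on $\mathbb{N}$ such that $\mu_\alpha^{\mathcal{F}}(A)=x$.
   Context: $\mathbb{N}=\{1,2,3,\dots\}$. For $\alpha\ge-1$ and $A\subseteq\mathbb{N}$ put $A_\alpha(n)=\sum_{k=1}^n\chi_A(k)k^\alpha$ (so $\mathbb{N}_\alpha(n)=\sum_{k=1}^nk^\alpha$), $\underline{d}_\alpha(A)=\liminf_{n\to\infty}\frac{A_\alpha(n)}{\mathbb{N}_\alpha(n)}$ and $\overline{d}_\alpha(A)=\limsup_{n\to\infty}\frac{A_\alpha(n)}{\mathbb{N}_\alpha(n)}$. For a free ultrafilter $\mathcal{F}$ and a bounded real sequence $(x_n)$, $\mathcal{F}\text{-}\lim x_n$ is the unique real $L$ with $\{n;|x_n-L|<\varepsilon\}\in\mathcal{F}$ for every $\varepsilon>0$. Define $\mu_\alpha^{\mathcal{F}}(A)=\mathcal{F}\text{-}\lim\frac{A_\alpha(n)}{\mathbb{N}_\alpha(n)}$. *)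

theory Defs
  imports "HOL-Analysis.Analysis"
begin

definition wcount :: "real \<Rightarrow> nat set \<Rightarrow> nat \<Rightarrow> real" where
  "wcount \<alpha> A n = (\<Sum>k=1..n. (if k \<in> A then 1 else 0) * real k powr \<alpha>)"

definition wratio :: "real \<Rightarrow> nat set \<Rightarrow> nat \<Rightarrow> real" where
  "wratio \<alpha> A n = wcount \<alpha> A n / wcount \<alpha> UNIV n"

definition lower_wdens :: "real \<Rightarrow> nat set \<Rightarrow> ereal" where
  "lower_wdens \<alpha> A = liminf (\<lambda>n. ereal (wratio \<alpha> A n))"

definition upper_wdens :: "real \<Rightarrow> nat set \<Rightarrow> ereal" where
  "upper_wdens \<alpha> A = limsup (\<lambda>n. ereal (wratio \<alpha> A n))"

definition free_ultrafilter :: "nat set set \<Rightarrow> bool" where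
  "free_ultrafilter F \<longleftrightarrow>
     UNIV \<in> F \<and> {} \<notin> F \<and>
     (\<forall>X Y. X \<in> F \<longrightarrow> X \<subseteq> Y \<longrightarrow> Y \<in> F) \<and>
     (\<forall>X Y. X \<in> F \<longrightarrow> Y \<in> F \<longrightarrow> X \<inter> Y \<in> F) \<and>
     (\<forall>X. X \<in> F \<or> - X \<in> F) \<and>
     (\<forall>X. finite X \<longrightarrow> X \<notin> F)"

definition F_lim :: "nat set set \<Rightarrow> (nat \<Rightarrow> real) \<Rightarrow> real" where
  "F_lim F x = (THE L. \<forall>\<epsilon>>0. {n. \<bar>x n - L\<bar> < \<epsilon>} \<in> F)"

definition mu_F :: "nat set set \<Rightarrow> real \<Rightarrow> nat set \<Rightarrow> real" where
  "mu_F F \<alpha> A = F_lim F (wratio \<alpha> A)"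

end

theory Submission
  imports Defs
begin

text \<open>
  Consecutive ratios \<open>A\<^sub>\<alpha>(n)/\<nat>\<^sub>\<alpha>(n)\<close> differ by at most \<open>n\<^sup>\<alpha>/\<nat>\<^sub>\<alpha>(n) = O(1/n)\<close>, so the
  sequence cannot jump over a window around \<open>x\<close>; since it goes below \<open>x + \<epsilon>\<close> and above
  \<open>x - \<epsilon>\<close> infinitely often, it enters every window around \<open>x\<close> infinitely often. Hence the
  sets \<open>{n \<ge> N. |A\<^sub>\<alpha>(n)/\<nat>\<^sub>\<alpha>(n) - x| < \<epsilon>}\<close> have the finite intersection property, and any
  ultrafilter refining them (obtained by Zorn's lemma) is free and has \<open>F\<close>-limit \<open>x\<close>.
\<close>

lemma frequently_less_of_Liminf_less:
  fixes f :: "'a \<Rightarrow> 'b::complete_linorder"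
  assumes "Liminf F f < y"
  shows "\<exists>\<^sub>F n in F. f n < y"
  using assms Liminf_bounded[of y f F] by (auto simp: frequently_def not_less)

lemma frequently_greater_of_less_Limsup:
  fixes f :: "'a \<Rightarrow> 'b::complete_linorder"
  assumes "y < Limsup F f"
  shows "\<exists>\<^sub>F n in F. y < f n"
  using assms Limsup_bounded[of f y F] by (auto simp: frequently_def not_less)

lemma small_steps_hit_interval:
  fixes w :: "nat \<Rightarrow> real"
  assumes steps: "\<And>n. m \<le> n \<Longrightarrow> \<bar>w (Suc n) - w n\<bar> < e"
    and "m \<le> p" and "w m < x + e" and "x - e < w p"
  shows "\<exists>q\<in>{m..p}. \<bar>w q - x\<bar> < e"
  using \<open>m \<le> p\<close> \<open>x - e < w p\<close>
proof (induction p rule: dec_induct)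
  case base
  then show ?case using \<open>w m < x + e\<close> by auto
next
  case (step p)
  show ?case
  proof (cases "x - e < w p")
    case True
    with step.IH show ?thesis by auto
  next
    case False
    with steps[OF step.hyps(1)] step.prems have "\<bar>w (Suc p) - x\<bar> < e" by auto
    with step.hyps(1) show ?thesis by auto
  qed
qed

lemma frequently_near_of_between_liminf_limsup:
  fixes w :: "nat \<Rightarrow> real"
  assumes steps: "(\<lambda>n. w (Suc n) - w n) \<longlonglongrightarrow> 0"
    and lower: "liminf (\<lambda>n. ereal (w n)) \<le> ereal x"
    and upper: "ereal x \<le> limsup (\<lambda>n. ereal (w n))"
    and "e > 0"
  shows "\<exists>\<^sub>F n in sequentially. \<bar>w n - x\<bar> < e"
  unfolding frequently_sequentially
proof
  fix N
  obtain N0 where N0: "\<And>n. N0 \<le> n \<Longrightarrow> \<bar>w (Suc n) - w n\<bar> < e"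
    using steps \<open>e > 0\<close> by (auto simp: LIMSEQ_iff)
  have "liminf (\<lambda>n. ereal (w n)) < ereal (x + e)"
    using lower \<open>e > 0\<close> by (simp add: le_less_trans)
  then have "\<forall>N. \<exists>n\<ge>N. w n < x + e"
    by (auto dest: frequently_less_of_Liminf_less simp: frequently_sequentially)
  then obtain m where m: "max N N0 \<le> m" "w m < x + e"
    by blast
  have "ereal (x - e) < ereal x"
    using \<open>e > 0\<close> by simp
  then have "ereal (x - e) < limsup (\<lambda>n. ereal (w n))"
    using upper by (rule less_le_trans)
  then have "\<forall>N. \<exists>n\<ge>N. x - e < w n"
    by (auto dest: frequently_greater_of_less_Limsup simp: frequently_sequentially)
  then obtain p where p: "m \<le> p" "x - e < w p"
    by blast
  from small_steps_hit_interval[of m w e p x] N0 m p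
  obtain q where "q \<in> {m..p}" "\<bar>w q - x\<bar> < e" by fastforce
  with m show "\<exists>n\<ge>N. \<bar>w n - x\<bar> < e"
    by (intro exI[of _ q]) auto
qed

lemma inf_filtercomap_nhds_neq_bot:
  fixes f :: "'a \<Rightarrow> 'b::metric_space"
  assumes near: "\<And>e. e > 0 \<Longrightarrow> \<exists>\<^sub>F n in F. dist (f n) x < e"
  shows "inf F (filtercomap f (nhds x)) \<noteq> bot"
proof
  assume "inf F (filtercomap f (nhds x)) = bot"
  then have "eventually (\<lambda>_. False) (inf F (filtercomap f (nhds x)))"
    by simp
  then obtain P Q where P: "eventually P F" and Q: "eventually Q (filtercomap f (nhds x))"
    and disjoint: "\<And>n. P n \<Longrightarrow> Q n \<Longrightarrow> False"
    unfolding eventually_inf by blast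
  from Q obtain S where "open S" "x \<in> S" and S: "\<And>n. f n \<in> S \<Longrightarrow> Q n"
    by (auto simp: eventually_filtercomap_nhds)
  then obtain e where "e > 0" and ball: "ball x e \<subseteq> S"
    using open_contains_ball by blast
  from frequently_eventually_conj[OF near[OF \<open>e > 0\<close>] P]
  obtain n where "P n" "dist (f n) x < e"
    by (auto dest: frequently_ex)
  then have "f n \<in> ball x e"
    by (simp add: dist_commute)
  with ball S disjoint \<open>P n\<close> show False by blast
qed

lemma exists_maximal_proper_filter_le:
  fixes F :: "'a filter"
  assumes F: "F \<noteq> bot"
  shows "\<exists>U. U \<le> F \<and> U \<noteq> bot \<and> (\<forall>G. G \<noteq> bot \<longrightarrow> G \<le> U \<longrightarrow> G = U)"
proof -
  let ?R = "{(b, a). a \<noteq> bot \<and> a \<le> b \<and> b \<le> F}"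
  have bot_notin_R: "c \<in> Chains ?R \<Longrightarrow> bot \<notin> c" for c
    by (auto simp: Chains_def)
  have [simp]: "Field ?R = {G. G \<noteq> bot \<and> G \<le> F}"
    by (auto simp: Field_def bot_unique)
  have "\<exists>m\<in>Field ?R. \<forall>a\<in>Field ?R. (m, a) \<in> ?R \<longrightarrow> a = m"
  proof (rule Zorns_po_lemma)
    show "Partial_order ?R"
      by (auto simp: partial_order_on_def preorder_on_def
          antisym_def refl_on_def trans_def Field_def bot_unique)
    show "\<exists>u\<in>Field ?R. \<forall>a\<in>C. (a, u) \<in> ?R" if C: "C \<in> Chains ?R" for C
    proof (simp, intro exI conjI ballI)
      have Inf_C: "Inf C \<noteq> bot" "Inf C \<le> F" if "C \<noteq> {}"
      proof -
        from C that have "Inf C = bot \<longleftrightarrow> (\<exists>x\<in>C. x = bot)"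
          unfolding trivial_limit_def by (intro eventually_Inf_base) (auto simp: Chains_def)
        with C show "Inf C \<noteq> bot"
          by (simp add: bot_notin_R)
        from that obtain x where "x \<in> C" by auto
        with C show "Inf C \<le> F"
          by (auto intro!: Inf_lower2[of x] simp: Chains_def)
      qed
      then have [simp]: "inf F (Inf C) = (if C = {} then F else Inf C)"
        using C by (auto simp add: inf_absorb2)
      from C show "inf F (Inf C) \<noteq> bot"
        by (simp add: F Inf_C)
      from C show "inf F (Inf C) \<le> F"
        by (simp add: Chains_def Inf_C F)
      with C show "inf F (Inf C) \<le> x" "x \<le> F" if "x \<in> C" for x
        using that by (auto intro: Inf_lower simp: Chains_def)
    qed
  qed
  then show ?thesis by auto
qed

lemma eventually_or_eventually_not_if_maximal:
  assumes max: "\<And>G. G \<noteq> bot \<Longrightarrow> G \<le> U \<Longrightarrow> G = U"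
  shows "eventually P U \<or> eventually (\<lambda>x. \<not> P x) U"
proof (rule disjCI)
  assume "\<not> eventually (\<lambda>x. \<not> P x) U"
  then have "inf U (principal {x. P x}) \<noteq> bot"
    by (simp add: trivial_limit_def eventually_inf_principal)
  then have restrict: "inf U (principal {x. P x}) = U"
    by (rule max) simp
  show "eventually P U"
    by (subst restrict[symmetric]) (simp add: eventually_inf_principal)
qed

lemma exists_ultrafilter_le:
  fixes F :: "'a filter"
  assumes "F \<noteq> bot"
  shows "\<exists>U. U \<le> F \<and> U \<noteq> bot \<and> (\<forall>P. eventually P U \<or> eventually (\<lambda>x. \<not> P x) U)"
  using exists_maximal_proper_filter_le[OF assms] eventually_or_eventually_not_if_maximal by blast

lemma free_ultrafilter_eventually_sets:
  assumes "U \<le> sequentially" and "U \<noteq> bot"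
    and ultra: "\<And>P. eventually P U \<or> eventually (\<lambda>n. \<not> P n) U"
  shows "free_ultrafilter {X. eventually (\<lambda>n. n \<in> X) U}"
  unfolding free_ultrafilter_def
proof (intro conjI allI impI; simp)
  show "\<not> eventually (\<lambda>n. False) U"
    using \<open>U \<noteq> bot\<close> by (simp add: trivial_limit_def)
  show "eventually (\<lambda>n. n \<in> Y) U" if "eventually (\<lambda>n. n \<in> X) U" "X \<subseteq> Y" for X Y
    using that by (auto elim: eventually_mono)
  show "eventually (\<lambda>n. n \<in> X \<and> n \<in> Y) U"
    if "eventually (\<lambda>n. n \<in> X) U" "eventually (\<lambda>n. n \<in> Y) U" for X Y
    using that by (rule eventually_conj)
  show "eventually (\<lambda>n. n \<in> X) U \<or> eventually (\<lambda>n. n \<notin> X) U" for X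
    using ultra by blast
  show "\<not> eventually (\<lambda>n. n \<in> X) U" if "finite X" for X
  proof
    assume "eventually (\<lambda>n. n \<in> X) U"
    moreover have "eventually (\<lambda>n. n \<notin> X) U"
      using \<open>finite X\<close> \<open>U \<le> sequentially\<close>
      by (auto simp: cofinite_eq_sequentially[symmetric] eventually_cofinite intro: filter_leD)
    ultimately have "eventually (\<lambda>n. False) U"
      by (auto elim: eventually_elim2)
    with \<open>U \<noteq> bot\<close> show False by (simp add: trivial_limit_def)
  qed
qed

lemma F_lim_eqI:
  assumes "free_ultrafilter F" and near: "\<And>e. e > 0 \<Longrightarrow> {n. \<bar>w n - L\<bar> < e} \<in> F"
  shows "F_lim F w = L"
  unfolding F_lim_def
proof (rule the_equality)
  show "\<forall>e>0. {n. \<bar>w n - L\<bar> < e} \<in> F" using near by blast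
next
  fix L' assume near': "\<forall>e>0. {n. \<bar>w n - L'\<bar> < e} \<in> F"
  show "L' = L"
  proof (rule ccontr)
    assume "L' \<noteq> L"
    define e where "e = \<bar>L' - L\<bar> / 2"
    have "e > 0" using \<open>L' \<noteq> L\<close> by (simp add: e_def)
    then have "{n. \<bar>w n - L'\<bar> < e} \<inter> {n. \<bar>w n - L\<bar> < e} \<in> F"
      using assms near' by (simp add: free_ultrafilter_def)
    moreover have "{n. \<bar>w n - L'\<bar> < e} \<inter> {n. \<bar>w n - L\<bar> < e} = {}"
      by (auto simp: e_def abs_if)
    ultimately show False
      using \<open>free_ultrafilter F\<close> by (simp add: free_ultrafilter_def)
  qed
qed

lemma abs_add_frac_diff_le:
  fixes a b c d :: real
  assumes "0 \<le> a" "a \<le> b" "0 < b" "0 \<le> c" "0 \<le> d" "d \<le> 1"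
  shows "\<bar>(a + d * c) / (b + c) - a / b\<bar> \<le> c / (b + c)"
proof -
  have "0 \<le> d * b" "d * b \<le> b"
    using assms by (simp_all add: mult_left_le_one_le)
  then have "\<bar>d * b - a\<bar> \<le> b"
    using assms unfolding abs_le_iff by linarith
  then have le_1: "\<bar>(d * b - a) / b\<bar> \<le> 1"
    using \<open>0 < b\<close> by (simp add: abs_divide)
  have "(a + d * c) / (b + c) - a / b = (d * b - a) / b * (c / (b + c))"
    using assms by (simp add: field_simps)
  then have "\<bar>(a + d * c) / (b + c) - a / b\<bar> = \<bar>(d * b - a) / b\<bar> * (c / (b + c))"
    using assms by (simp add: abs_mult)
  also have "\<dots> \<le> c / (b + c)"
    using assms le_1 by (intro mult_left_le_one_le) auto
  finally show ?thesis .
qed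

lemma wcount_nonneg: "0 \<le> wcount \<alpha> A n"
  unfolding wcount_def by (intro sum_nonneg) auto

lemma wcount_le_wcount_UNIV: "wcount \<alpha> A n \<le> wcount \<alpha> UNIV n"
  unfolding wcount_def by (intro sum_mono) auto

lemma wcount_UNIV_pos: "n \<ge> 1 \<Longrightarrow> 0 < wcount \<alpha> UNIV n"
  unfolding wcount_def by (intro sum_pos) auto

lemma wcount_UNIV: "wcount \<alpha> UNIV n = (\<Sum>k=1..n. real k powr \<alpha>)"
  unfolding wcount_def by simp

lemma wcount_Suc:
  "wcount \<alpha> A (Suc n) = wcount \<alpha> A n + (if Suc n \<in> A then 1 else 0) * real (Suc n) powr \<alpha>"
  unfolding wcount_def by (simp add: sum.nat_ivl_Suc')

text \<open>For \<open>\<alpha> > 0\<close> the upper half of the terms already contributes \<open>(N/2)\<^sup>\<alpha>\<close> each.\<close>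

lemma powr_div_wcount_UNIV_le:
  assumes "N \<ge> 1"
  shows "real N powr \<alpha> / wcount \<alpha> UNIV N \<le> (if \<alpha> \<le> 0 then 1 else 2 * 2 powr \<alpha>) / real N"
proof (cases "\<alpha> \<le> 0")
  case True
  have "real N * real N powr \<alpha> = (\<Sum>k=1..N. real N powr \<alpha>)" by simp
  also have "\<dots> \<le> wcount \<alpha> UNIV N"
    unfolding wcount_UNIV by (intro sum_mono powr_mono2') (use True in auto)
  finally show ?thesis
    using True assms wcount_UNIV_pos[OF assms] by (simp add: field_simps)
next
  case False
  define M where "M = (N + 1) div 2"
  have "real N / 2 * (real N / 2) powr \<alpha> \<le> real (N + 1 - M) * (real N / 2) powr \<alpha>"
    by (intro mult_right_mono) (auto simp: M_def)
  also have "\<dots> = (\<Sum>k=M..N. (real N / 2) powr \<alpha>)" by simp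
  also have "\<dots> \<le> (\<Sum>k=M..N. real k powr \<alpha>)"
    by (intro sum_mono powr_mono2) (use False in \<open>auto simp: M_def\<close>)
  also have "\<dots> \<le> wcount \<alpha> UNIV N"
    unfolding wcount_UNIV by (intro sum_mono2) (use assms in \<open>auto simp: M_def\<close>)
  finally have "real N / 2 * (real N powr \<alpha> / 2 powr \<alpha>) \<le> wcount \<alpha> UNIV N"
    by (simp add: powr_divide)
  then show ?thesis
    using False assms wcount_UNIV_pos[OF assms] by (simp add: field_simps)
qed

lemma wratio_Suc_diff_tendsto_0: "(\<lambda>n. wratio \<alpha> A (Suc n) - wratio \<alpha> A n) \<longlonglongrightarrow> 0"
proof (rule Lim_null_comparison)
  define C where "C = (if \<alpha> \<le> 0 then 1 else 2 * 2 powr \<alpha>)"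
  show "(\<lambda>n. C / real (Suc n)) \<longlonglongrightarrow> 0"
    by (rule LIMSEQ_Suc) (rule lim_const_over_n)
  have "\<bar>wratio \<alpha> A (Suc n) - wratio \<alpha> A n\<bar> \<le> C / real (Suc n)" if "n \<ge> 1" for n
  proof -
    define d :: real where "d = (if Suc n \<in> A then 1 else 0)"
    have "wratio \<alpha> A (Suc n) = (wcount \<alpha> A n + d * real (Suc n) powr \<alpha>)
        / (wcount \<alpha> UNIV n + real (Suc n) powr \<alpha>)"
      by (simp add: wratio_def wcount_Suc d_def)
    then have "\<bar>wratio \<alpha> A (Suc n) - wratio \<alpha> A n\<bar>
        \<le> real (Suc n) powr \<alpha> / (wcount \<alpha> UNIV n + real (Suc n) powr \<alpha>)"
      unfolding wratio_def[of \<alpha> A n]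
      by (simp only:) (intro abs_add_frac_diff_le wcount_nonneg wcount_le_wcount_UNIV
          wcount_UNIV_pos that powr_ge_zero, simp_all add: d_def)
    also have "\<dots> \<le> C / real (Suc n)"
      using powr_div_wcount_UNIV_le[of "Suc n" \<alpha>] by (simp add: C_def wcount_Suc)
    finally show ?thesis .
  qed
  then show "\<forall>\<^sub>F n in sequentially. norm (wratio \<alpha> A (Suc n) - wratio \<alpha> A n) \<le> C / real (Suc n)"
    by (auto simp: eventually_sequentially)
qed

theorem corollary4p2:
  fixes A :: "nat set" and \<alpha> x :: real
  assumes "\<alpha> \<ge> -1"
    and "lower_wdens \<alpha> A \<le> ereal x" and "ereal x \<le> upper_wdens \<alpha> A"
  shows "\<exists>F. free_ultrafilter F \<and> mu_F F \<alpha> A = x"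
proof -
  let ?w = "wratio \<alpha> A"
  have "inf sequentially (filtercomap ?w (nhds x)) \<noteq> bot"
    using frequently_near_of_between_liminf_limsup[OF wratio_Suc_diff_tendsto_0] assms(2,3)
    by (intro inf_filtercomap_nhds_neq_bot)
      (simp add: lower_wdens_def upper_wdens_def dist_real_def)
  then obtain U where U: "U \<le> inf sequentially (filtercomap ?w (nhds x))" "U \<noteq> bot"
    and ultra: "\<And>P. eventually P U \<or> eventually (\<lambda>n. \<not> P n) U"
    using exists_ultrafilter_le by blast
  then have "U \<le> sequentially" and lim: "(?w \<longlongrightarrow> x) U"
    by (auto simp: le_inf_iff intro: filterlim_mono[OF filterlim_filtercomap order_refl])
  define F where "F = {X. eventually (\<lambda>n. n \<in> X) U}"
  have F: "free_ultrafilter F"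
    unfolding F_def using \<open>U \<le> sequentially\<close> U(2) ultra by (rule free_ultrafilter_eventually_sets)
  moreover have "mu_F F \<alpha> A = x"
    unfolding mu_F_def using F
    by (rule F_lim_eqI) (use lim in \<open>auto simp: F_def tendsto_iff dist_real_def\<close>)
  ultimately show ?thesis by blast
qed

end
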